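(* Let $P_0,P_1$ be probability measures on a measurable space $\mathcal Y$ with $P_1\ll P_0$ and $\rho^2:=\chi^2(P_1\Vert P_0)<\infty$. Let $1\le k\le m$ be integers. For $S\subseteq[m]=\{1,\dots,m\}$ with $|S|=k$, let $P_S$ be the product law on $\mathcal Y^m$ whose $i$-th coordinate has law $P_1$ if $i\in S$ and $P_0$ if $i\notin S$. For a (possibly randomized) test $\phi_m:\mathcal Y^m\to[0,1]$ (measurable), let $a_m=\mathbb E_{P_0^{\otimes m}}[\phi_m]$ and let $$\bar b_{m,k}=\binom mk^{-1}\sum_{S\subseteq[m],\,|S|=k}\mathbb E_{P_S}[1-\phi_m]$$ be the type-II error averaged uniformly over the $k$-subsets. Let $J=|S\cap S'|$, where $S,S'$ are independent uniformly random $k$-subsets of $[m]$. Then every test satisfies $$a_m+\bar b_{m,k}\ \ge\ 1-\min\{1,C^{\rm fix}_{m,k}\},\qquad C^{\rm fix}_{m,k}:=\frac12\sqrt{\mathbb E(1+\rho^2)^J-1},$$ and moreover $$\mathbb E(1+\rho^2)^J\ \le\ \left(1+\frac{k\rho^2}{m}\right)^k .$$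
   Context: $\chi^2(P_1\Vert P_0)=\mathbb E_{P_0}[(\mathrm dP_1/\mathrm dP_0-1)^2]$. The value of a test is its probability of rejecting the null hypothesis that all $m$ observations are i.i.d. from $P_0$. *)

theory Defs
  imports "HOL-Probability.Probability"
begin

text \<open>
  The divergence takes values in \<^typ>\<open>ennreal\<close>, so that its finiteness is a genuine hypothesis.
  In the library's argument order \<^term>\<open>RN_deriv P0 P1\<close> is $dP_1/dP_0$; it is finite
  $P_0$-almost everywhere when $P_1 \ll P_0$, so \<^const>\<open>enn2real\<close> changes it on a null set only.
\<close>

definition chi2_div :: "'a measure \<Rightarrow> 'a measure \<Rightarrow> ennreal" where
  "chi2_div P1 P0 = (\<integral>\<^sup>+ y. ennreal ((enn2real (RN_deriv P0 P1 y) - 1)\<^sup>2) \<partial>P0)"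

definition k_subsets :: "nat \<Rightarrow> nat \<Rightarrow> nat set set" where
  "k_subsets m k = {S. S \<subseteq> {1..m} \<and> card S = k}"

definition planted_law :: "nat \<Rightarrow> 'a measure \<Rightarrow> 'a measure \<Rightarrow> nat set \<Rightarrow> (nat \<Rightarrow> 'a) measure" where
  "planted_law m P0 P1 S = (\<Pi>\<^sub>M i\<in>{1..m}. if i \<in> S then P1 else P0)"

definition null_law :: "nat \<Rightarrow> 'a measure \<Rightarrow> (nat \<Rightarrow> 'a) measure" where
  "null_law m P0 = (\<Pi>\<^sub>M i\<in>{1..m}. P0)"

text \<open>
  Only the $\sigma$-algebra of \<^term>\<open>null_law m P0\<close> matters in the next definition; it is also the
  one of every \<^term>\<open>planted_law m P0 P1 S\<close> when \<^prop>\<open>sets P1 = sets P0\<close>. The value of a test is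
  its conditional probability of rejecting the null hypothesis.
\<close>

definition is_test :: "nat \<Rightarrow> 'a measure \<Rightarrow> ((nat \<Rightarrow> 'a) \<Rightarrow> real) \<Rightarrow> bool" where
  "is_test m P0 \<phi> \<longleftrightarrow>
     \<phi> \<in> borel_measurable (null_law m P0) \<and> (\<forall>x\<in>space (null_law m P0). 0 \<le> \<phi> x \<and> \<phi> x \<le> 1)"

definition type1_error :: "nat \<Rightarrow> 'a measure \<Rightarrow> ((nat \<Rightarrow> 'a) \<Rightarrow> real) \<Rightarrow> real" where
  "type1_error m P0 \<phi> = (\<integral>x. \<phi> x \<partial>null_law m P0)"

definition avg_type2_error ::
  "nat \<Rightarrow> nat \<Rightarrow> 'a measure \<Rightarrow> 'a measure \<Rightarrow> ((nat \<Rightarrow> 'a) \<Rightarrow> real) \<Rightarrow> real" where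
  "avg_type2_error m k P0 P1 \<phi> =
     inverse (real (m choose k)) * (\<Sum>S\<in>k_subsets m k. \<integral>x. 1 - \<phi> x \<partial>planted_law m P0 P1 S)"

definition overlap_pmf :: "nat \<Rightarrow> nat \<Rightarrow> nat pmf" where
  "overlap_pmf m k =
     map_pmf (\<lambda>(S, S'). card (S \<inter> S'))
       (pair_pmf (pmf_of_set (k_subsets m k)) (pmf_of_set (k_subsets m k)))"

definition C_fix :: "nat \<Rightarrow> nat \<Rightarrow> real \<Rightarrow> real" where
  "C_fix m k \<rho> =
     1 / 2 * sqrt (measure_pmf.expectation (overlap_pmf m k) (\<lambda>J. (1 + \<rho>\<^sup>2) ^ J) - 1)"

end

(* The average of the laws P_S has density L = avg_S L_S with respect to the null law, where
   L_S(x) is the product of (dP1/dP0)(x_i) over i in S. By Le Cam's argument the sum of the two errors is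
   1 + E[(1/2 - phi)(L - 1)], which is at least 1 - (1/2) sqrt(E[L^2] - 1) by Cauchy-Schwarz.
   Independence gives E[L_S L_S'] = (1 + rho^2)^|S \<inter> S'|, so E[L^2] = E(1 + rho^2)^J. For the moment
   bound, (1 + x)^J is the sum of x^|A| over all A contained in both S and S', and a given A \<subseteq> S is
   contained in the random set S' with probability at most (k/m)^|A|. *)
theory Submission
  imports Defs
begin

section \<open>The overlap of two random subsets\<close>

lemma finite_k_subsets: "finite (k_subsets m k)"
  unfolding k_subsets_def by (rule finite_subset[of _ "Pow {1..m}"]) auto

lemma card_k_subsets: "card (k_subsets m k) = m choose k"
  unfolding k_subsets_def by (subst n_subsets) auto

lemma k_subsets_nonempty: "k \<le> m \<Longrightarrow> k_subsets m k \<noteq> {}"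
  by (metis card_k_subsets card.empty zero_less_binomial less_irrefl)

text \<open>Makes the law of the overlap elementary: all pairs of subsets have the same weight. The
  resulting double sum is the form in which both the moment bound and the second moment of the
  mixture density are handled.\<close>

lemma expectation_overlap_pmf:
  fixes f :: "nat \<Rightarrow> real"
  assumes "k \<le> m"
  shows "measure_pmf.expectation (overlap_pmf m k) f =
           (\<Sum>S\<in>k_subsets m k. \<Sum>S'\<in>k_subsets m k. f (card (S \<inter> S'))) / (real (m choose k))\<^sup>2"
proof -
  let ?K = "k_subsets m k"
  note K = finite_k_subsets[of m k] k_subsets_nonempty[OF assms]
  have "measure_pmf.expectation (overlap_pmf m k) f =
      (\<Sum>p\<in>?K \<times> ?K. pmf (pair_pmf (pmf_of_set ?K) (pmf_of_set ?K)) p *\<^sub>R f (card (fst p \<inter> snd p)))"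
    unfolding overlap_pmf_def integral_map_pmf
    by (subst integral_measure_pmf[of "?K \<times> ?K"]) (use K in \<open>auto simp: case_prod_beta\<close>)
  also have "\<dots> = (\<Sum>p\<in>?K \<times> ?K. f (card (fst p \<inter> snd p)) / (real (m choose k))\<^sup>2)"
    by (intro sum.cong refl)
       (auto simp: pmf_pair pmf_of_set[OF K(2,1)] card_k_subsets power2_eq_square)
  also have "\<dots> = (\<Sum>S\<in>?K. \<Sum>S'\<in>?K. f (card (S \<inter> S'))) / (real (m choose k))\<^sup>2"
    by (simp add: sum.cartesian_product case_prod_beta sum_divide_distrib)
  finally show ?thesis .
qed

text \<open>Removing \<open>A\<close> from a superset is a bijection onto the subsets of the
  complement of \<open>A\<close> with \<open>k - card A\<close> elements. If \<open>card A\<close>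
  exceeded \<open>k\<close>, truncated subtraction would make the right side 1 although no such
  superset exists.\<close>

lemma card_k_subsets_superset:
  assumes "A \<subseteq> {1..m}" "card A \<le> k"
  shows "card {S \<in> k_subsets m k. A \<subseteq> S} = (m - card A) choose (k - card A)"
proof -
  have fin: "finite A" using assms(1) finite_subset by blast
  have "bij_betw (\<lambda>B. B \<union> A) {B. B \<subseteq> {1..m} - A \<and> card B = k - card A}
          {S \<in> k_subsets m k. A \<subseteq> S}"
  proof (rule bij_betw_byWitness[where f' = "\<lambda>S. S - A"])
    show "(\<lambda>B. B \<union> A) ` {B. B \<subseteq> {1..m} - A \<and> card B = k - card A}
        \<subseteq> {S \<in> k_subsets m k. A \<subseteq> S}"
    proof safe
      fix B assume B: "B \<subseteq> {1..m} - A" "card B = k - card A"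
      have "finite B" using B(1) by (rule finite_subset) simp
      hence "card (B \<union> A) = k"
        using B fin assms(2) by (subst card_Un_disjoint) auto
      thus "B \<union> A \<in> k_subsets m k" using B assms(1) by (auto simp: k_subsets_def)
    qed
    show "(\<lambda>S. S - A) ` {S \<in> k_subsets m k. A \<subseteq> S}
        \<subseteq> {B. B \<subseteq> {1..m} - A \<and> card B = k - card A}"
    proof (rule image_subsetI)
      fix S assume "S \<in> {S \<in> k_subsets m k. A \<subseteq> S}"
      thus "S - A \<in> {B. B \<subseteq> {1..m} - A \<and> card B = k - card A}"
        using fin by (simp add: k_subsets_def card_Diff_subset Diff_mono)
    qed
  qed blast+
  hence "card {S \<in> k_subsets m k. A \<subseteq> S} = card {B. B \<subseteq> {1..m} - A \<and> card B = k - card A}"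
    by (rule bij_betw_same_card[symmetric])
  also have "\<dots> = card ({1..m} - A) choose (k - card A)"
    by (rule n_subsets) simp
  also have "card ({1..m} - A) = m - card A"
    using assms fin by (simp add: card_Diff_subset)
  finally show ?thesis .
qed

text \<open>The ratio of the two binomials is the product of \<open>(k - i) / (m - i)\<close> over
  \<open>i < j\<close>, and each factor is at most \<open>k / m\<close> because
  \<open>k \<le> m\<close>. The induction splits off the factor with \<open>i = 0\<close>, which is
  why \<open>m\<close> and \<open>k\<close> are generalized.\<close>

lemma binomial_diff_le:
  assumes "j \<le> k" "k \<le> m"
  shows "real ((m - j) choose (k - j)) \<le> (real k / real m) ^ j * real (m choose k)"
  using assms
proof (induction j arbitrary: m k)
  case 0
  show ?case by simp
next
  case (Suc j)
  obtain m' k' where m: "m = Suc m'" and k: "k = Suc k'"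
    using Suc.prems by (metis Suc_le_D le_trans)
  have le: "j \<le> k'" "k' \<le> m'" using Suc.prems m k by auto
  \<comment> \<open>The next factor, \<open>(k - 1) / (m - 1)\<close>, is no larger than
    \<open>k / m\<close>. For \<open>m' = 0\<close> the left side is a division by zero, hence
    0.\<close>
  have "real k' / real m' \<le> real k / real m"
    using le by (cases "m' = 0") (auto simp: m k field_simps)
  hence pow: "(real k' / real m') ^ j \<le> (real k / real m) ^ j"
    by (intro power_mono) auto
  have "Suc m' * (m' choose k') = (Suc m' choose Suc k') * Suc k'"
    by (rule Suc_times_binomial_eq)
  hence "real m * real (m' choose k') = real (m choose k) * real k"
    unfolding m k by (metis of_nat_mult)
  hence step: "real (m' choose k') = real k / real m * real (m choose k)"
    by (simp add: m field_simps)
  have "real ((m - Suc j) choose (k - Suc j)) = real ((m' - j) choose (k' - j))"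
    by (simp add: m k)
  also have "\<dots> \<le> (real k' / real m') ^ j * real (m' choose k')"
    by (rule Suc.IH[OF le])
  also have "\<dots> \<le> (real k / real m) ^ j * real (m' choose k')"
    using pow by (rule mult_right_mono) simp
  also have "\<dots> = (real k / real m) ^ Suc j * real (m choose k)"
    by (simp add: step)
  finally show ?case .
qed

text \<open>The binomial theorem indexed by the subsets themselves instead of their sizes, so that
  the order of summation can be exchanged later.\<close>

lemma one_plus_power_card:
  fixes x :: "'b::comm_semiring_1"
  assumes "finite S"
  shows "(1 + x) ^ card S = (\<Sum>A\<in>Pow S. x ^ card A)"
  using prod_add[OF assms, of "\<lambda>_. x" "\<lambda>_. 1"] by (simp add: add.commute)

text \<open>The bound holds for every fixed \<open>S\<close>, not only on average. Expanding over
  subsets \<open>A\<close> and exchanging sums leaves, for each \<open>A\<close>, the number of sets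
  \<open>S'\<close> that contain it.\<close>

lemma sum_power_overlap_le:
  fixes x :: real
  assumes "0 \<le> x" "k \<le> m" "S \<in> k_subsets m k"
  shows "(\<Sum>S'\<in>k_subsets m k. (1 + x) ^ card (S \<inter> S'))
           \<le> (1 + real k * x / real m) ^ k * real (m choose k)"
proof -
  let ?K = "k_subsets m k"
  have S: "S \<subseteq> {1..m}" "card S = k" "finite S"
    using assms(3) by (auto simp: k_subsets_def intro: finite_subset)
  have "(\<Sum>S'\<in>?K. (1 + x) ^ card (S \<inter> S')) = (\<Sum>S'\<in>?K. \<Sum>A\<in>Pow (S \<inter> S'). x ^ card A)"
    using S(3) by (simp add: one_plus_power_card)
  \<comment> \<open>The range of \<open>A\<close> becomes the fixed set \<open>Pow S\<close> with a
    side condition on \<open>S'\<close>, the shape needed for the exchange.\<close>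
  also have "\<dots> = (\<Sum>S'\<in>?K. \<Sum>A\<in>{A \<in> Pow S. A \<subseteq> S'}. x ^ card A)"
    by (intro sum.cong) auto
  also have "\<dots> = (\<Sum>A\<in>Pow S. \<Sum>S'\<in>{S' \<in> ?K. A \<subseteq> S'}. x ^ card A)"
    by (rule sum.swap_restrict) (use S(3) in \<open>auto simp: finite_k_subsets\<close>)
  also have "\<dots> = (\<Sum>A\<in>Pow S. real ((m - card A) choose (k - card A)) * x ^ card A)"
  proof (intro sum.cong refl)
    fix A assume "A \<in> Pow S"
    hence "A \<subseteq> {1..m}" "card A \<le> k" using S by (auto intro: card_mono)
    thus "(\<Sum>S'\<in>{S' \<in> ?K. A \<subseteq> S'}. x ^ card A)
        = real ((m - card A) choose (k - card A)) * x ^ card A"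
      by (simp add: card_k_subsets_superset)
  qed
  also have "\<dots> \<le> (\<Sum>A\<in>Pow S. (real k / real m) ^ card A * real (m choose k) * x ^ card A)"
  proof (intro sum_mono mult_right_mono)
    fix A assume "A \<in> Pow S"
    hence "card A \<le> k" using S by (auto intro: card_mono)
    thus "real ((m - card A) choose (k - card A)) \<le> (real k / real m) ^ card A * real (m choose k)"
      using assms(2) by (rule binomial_diff_le)
  qed (use assms(1) in simp)
  also have "\<dots> = (\<Sum>A\<in>Pow S. (real k * x / real m) ^ card A) * real (m choose k)"
    unfolding sum_distrib_right
    by (intro sum.cong refl) (simp add: power_mult_distrib power_divide)
  \<comment> \<open>The subset expansion is now read backwards, with \<open>k * x / m\<close> in
    place of \<open>x\<close>.\<close>
  also have "(\<Sum>A\<in>Pow S. (real k * x / real m) ^ card A) = (1 + real k * x / real m) ^ k"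
    using one_plus_power_card[OF S(3), of "real k * x / real m"] S(2) by simp
  finally show ?thesis .
qed

lemma expectation_power_overlap_le:
  fixes x :: real
  assumes "0 \<le> x" "k \<le> m"
  shows "measure_pmf.expectation (overlap_pmf m k) (\<lambda>J. (1 + x) ^ J)
           \<le> (1 + real k * x / real m) ^ k"
proof -
  have pos: "0 < real (m choose k)" using assms(2) by simp
  have "(\<Sum>S\<in>k_subsets m k. \<Sum>S'\<in>k_subsets m k. (1 + x) ^ card (S \<inter> S'))
      \<le> (\<Sum>S\<in>k_subsets m k. (1 + real k * x / real m) ^ k * real (m choose k))"
    by (intro sum_mono sum_power_overlap_le assms)
  also have "\<dots> = (1 + real k * x / real m) ^ k * (real (m choose k))\<^sup>2"
    by (simp add: card_k_subsets power2_eq_square)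
  finally show ?thesis
    using pos by (simp add: expectation_overlap_pmf[OF assms(2)] pos_divide_le_eq)
qed

section \<open>Densities and testing\<close>

text \<open>A product measure is determined by its values on boxes. There Tonelli factorizes the
  integral of the product density into the coordinate integrals.\<close>

lemma PiM_density:
  fixes f :: "'i \<Rightarrow> 'a \<Rightarrow> ennreal"
  assumes "product_sigma_finite M" "product_sigma_finite (\<lambda>i. density (M i) (f i))"
    and I: "finite I" and f: "\<And>i. i \<in> I \<Longrightarrow> f i \<in> borel_measurable (M i)"
  shows "PiM I (\<lambda>i. density (M i) (f i)) = density (PiM I M) (\<lambda>x. \<Prod>i\<in>I. f i (x i))"
proof -
  interpret M: product_sigma_finite M by fact
  interpret D: product_sigma_finite "\<lambda>i. density (M i) (f i)" by fact
  note [measurable] = f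
  have "density (PiM I M) (\<lambda>x. \<Prod>i\<in>I. f i (x i)) = PiM I (\<lambda>i. density (M i) (f i))"
  proof (rule D.PiM_eqI[OF I])
    show "sets (density (PiM I M) (\<lambda>x. \<Prod>i\<in>I. f i (x i)))
        = sets (PiM I (\<lambda>i. density (M i) (f i)))"
      by (auto intro!: sets_PiM_cong)
  next
    fix A assume "\<And>i. i \<in> I \<Longrightarrow> A i \<in> sets (density (M i) (f i))"
    hence A [measurable]: "\<And>i. i \<in> I \<Longrightarrow> A i \<in> sets (M i)" by simp
    have "emeasure (density (PiM I M) (\<lambda>x. \<Prod>i\<in>I. f i (x i))) (Pi\<^sub>E I A)
        = (\<integral>\<^sup>+x. (\<Prod>i\<in>I. f i (x i)) * indicator (Pi\<^sub>E I A) x \<partial>PiM I M)"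
      using I by (intro emeasure_density) (auto intro!: sets_PiM_I_finite A)
    also have "\<dots> = (\<integral>\<^sup>+x. (\<Prod>i\<in>I. f i (x i) * indicator (A i) (x i)) \<partial>PiM I M)"
    proof (intro nn_integral_cong)
      fix x assume "x \<in> space (PiM I M)"
      \<comment> \<open>Points of the product space are extensional, so membership in the box is
        decided by the coordinates in \<open>I\<close> alone.\<close>
      hence "(indicator (Pi\<^sub>E I A) x :: ennreal) = (\<Prod>i\<in>I. indicator (A i) (x i))"
        using I by (auto simp: indicator_def PiE_iff space_PiM prod_zero_iff)
      thus "(\<Prod>i\<in>I. f i (x i)) * indicator (Pi\<^sub>E I A) x
          = (\<Prod>i\<in>I. f i (x i) * indicator (A i) (x i))"
        by (simp add: prod.distrib)
    qed
    also have "\<dots> = (\<Prod>i\<in>I. \<integral>\<^sup>+x. f i x * indicator (A i) x \<partial>M i)"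
      using I by (intro M.product_nn_integral_prod) auto
    also have "\<dots> = (\<Prod>i\<in>I. emeasure (density (M i) (f i)) (A i))"
      by (intro prod.cong refl) (simp add: emeasure_density)
    finally show "emeasure (density (PiM I M) (\<lambda>x. \<Prod>i\<in>I. f i (x i))) (Pi\<^sub>E I A)
        = (\<Prod>i\<in>I. emeasure (density (M i) (f i)) (A i))" .
  qed
  thus ?thesis by simp
qed

text \<open>This is the nonnegativity of the variance of \<open>\<bar>X\<bar>\<close>.\<close>

lemma (in prob_space) expectation_abs_le_sqrt:
  fixes X :: "'a \<Rightarrow> real"
  assumes "integrable M X" "integrable M (\<lambda>x. (X x)\<^sup>2)"
  shows "expectation (\<lambda>x. \<bar>X x\<bar>) \<le> sqrt (expectation (\<lambda>x. (X x)\<^sup>2))"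
proof -
  have "0 \<le> expectation (\<lambda>x. (X x)\<^sup>2) - (expectation (\<lambda>x. \<bar>X x\<bar>))\<^sup>2"
    using variance_positive[of "\<lambda>x. \<bar>X x\<bar>"] variance_eq[of "\<lambda>x. \<bar>X x\<bar>"] assms by simp
  thus ?thesis by (intro real_le_rsqrt) simp
qed

text \<open>Le Cam's bound, with \<open>L\<close> in the role of the density of the alternative with
  respect to the null law \<open>M\<close>; the second expectation is then the type-II
  error.\<close>

lemma (in prob_space) testing_error_ge:
  fixes L \<phi> :: "'a \<Rightarrow> real"
  assumes L: "L \<in> borel_measurable M" "integrable M (\<lambda>x. (L x)\<^sup>2)" "expectation L = 1"
    and \<phi>: "\<phi> \<in> borel_measurable M" "\<And>x. x \<in> space M \<Longrightarrow> 0 \<le> \<phi> x \<and> \<phi> x \<le> 1"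
  shows "expectation \<phi> + expectation (\<lambda>x. L x * (1 - \<phi> x))
           \<ge> 1 - 1 / 2 * sqrt (expectation (\<lambda>x. (L x)\<^sup>2) - 1)"
proof -
  note [measurable] = L(1) \<phi>(1)
  have iL: "integrable M L" using L(1,2) by (rule square_integrable_imp_integrable)
  have i\<phi>: "integrable M \<phi>"
    by (rule integrable_const_bound[where B = 1]) (use \<phi> in auto)
  have iL\<phi>: "integrable M (\<lambda>x. L x * (1 - \<phi> x))"
  proof (rule Bochner_Integration.integrable_bound[OF iL])
    show "AE x in M. norm (L x * (1 - \<phi> x)) \<le> norm (L x)"
      using \<phi>(2) by (intro AE_I2) (auto simp: abs_mult intro!: mult_left_le)
  qed simp
  have sq: "(\<lambda>x. (L x - 1)\<^sup>2) = (\<lambda>x. (L x)\<^sup>2 - 2 * L x + 1)"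
    by (auto simp: power2_eq_square algebra_simps)
  have isq: "integrable M (\<lambda>x. (L x - 1)\<^sup>2)"
    unfolding sq using L(2) iL by simp
  have Esq: "expectation (\<lambda>x. (L x - 1)\<^sup>2) = expectation (\<lambda>x. (L x)\<^sup>2) - 1"
    unfolding sq using L(2,3) iL by (simp add: prob_space)
  have "1 - 1 / 2 * expectation (\<lambda>x. \<bar>L x - 1\<bar>)
      = expectation (\<lambda>x. (1 + L x) / 2 - 1 / 2 * \<bar>L x - 1\<bar>)"
    using iL L(3) by (simp add: prob_space)
  also have "\<dots> \<le> expectation (\<lambda>x. \<phi> x + L x * (1 - \<phi> x))"
  proof (rule integral_mono)
    \<comment> \<open>Centring the test at \<open>1 / 2\<close> is what gives the constant
      \<open>1 / 2\<close>: a value in \<open>[0, 1]\<close> is at distance at most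
      \<open>1 / 2\<close> from the midpoint. The remaining term \<open>(1 + L) / 2\<close> has
      expectation 1.\<close>
    fix x assume "x \<in> space M"
    hence "\<bar>1 / 2 - \<phi> x\<bar> \<le> 1 / 2" using \<phi>(2)[of x] by linarith
    hence "\<bar>(1 / 2 - \<phi> x) * (L x - 1)\<bar> \<le> 1 / 2 * \<bar>L x - 1\<bar>"
      unfolding abs_mult by (rule mult_right_mono) simp
    moreover have "\<phi> x + L x * (1 - \<phi> x) = (1 + L x) / 2 + (1 / 2 - \<phi> x) * (L x - 1)"
      by (simp add: field_simps)
    ultimately show "(1 + L x) / 2 - 1 / 2 * \<bar>L x - 1\<bar> \<le> \<phi> x + L x * (1 - \<phi> x)"
      by linarith
  qed (use iL i\<phi> iL\<phi> in auto)
  also have "\<dots> = expectation \<phi> + expectation (\<lambda>x. L x * (1 - \<phi> x))"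
    using i\<phi> iL\<phi> by simp
  finally show ?thesis
    using expectation_abs_le_sqrt[of "\<lambda>x. L x - 1"] iL isq Esq by simp
qed

text \<open>Provides a version of the likelihood ratio that is real and nonnegative everywhere, so
  that the rest of the argument can use real integrals. Since \<open>l\<close> has mean 1, its
  second moment exceeds its variance, the divergence, by 1.\<close>

lemma chi2_density_moments:
  assumes "prob_space P0" "prob_space P1" "sets P1 = sets P0" "absolutely_continuous P0 P1"
    and "chi2_div P1 P0 < \<infinity>"
  obtains l where "l \<in> borel_measurable P0" "\<And>y. 0 \<le> l y" "P1 = density P0 (\<lambda>y. ennreal (l y))"
    "integrable P0 l" "(\<integral>y. l y \<partial>P0) = 1"
    "integrable P0 (\<lambda>y. (l y)\<^sup>2)" "(\<integral>y. (l y)\<^sup>2 \<partial>P0) = 1 + enn2real (chi2_div P1 P0)"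
proof
  interpret P0: prob_space P0 by fact
  interpret P1: prob_space P1 by fact
  define l where "l = (\<lambda>y. enn2real (RN_deriv P0 P1 y))"
  have lm [measurable]: "l \<in> borel_measurable P0" unfolding l_def by measurable
  show "l \<in> borel_measurable P0" by (rule lm)
  show l0: "0 \<le> l y" for y by (simp add: l_def)
  have "AE y in P0. RN_deriv P0 P1 y \<noteq> \<infinity>"
    by (rule P0.RN_deriv_finite) (use assms in \<open>auto intro: P1.sigma_finite_measure_axioms\<close>)
  hence AE: "AE y in P0. RN_deriv P0 P1 y = ennreal (l y)"
    by eventually_elim (auto simp: l_def ennreal_enn2real_if)
  have "density P0 (\<lambda>y. ennreal (l y)) = density P0 (RN_deriv P0 P1)"
    using AE by (intro density_cong) auto
  also have "\<dots> = P1" using assms(4,3) by (rule P0.density_RN_deriv)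
  finally show P1: "P1 = density P0 (\<lambda>y. ennreal (l y))" by simp
  \<comment> \<open>The mean of \<open>l\<close> is the total mass of \<open>P1\<close>.\<close>
  have "(\<integral>\<^sup>+y. ennreal (l y) \<partial>P0) = emeasure P1 (space P1)"
    by (subst (1 2) P1) (simp add: emeasure_density cong: nn_integral_cong)
  hence nn: "(\<integral>\<^sup>+y. ennreal (l y) \<partial>P0) = 1" by (simp add: P1.emeasure_space_1)
  show il: "integrable P0 l" by (rule integrableI_nonneg) (use l0 nn in auto)
  show El: "(\<integral>y. l y \<partial>P0) = 1"
    by (subst integral_eq_nn_integral) (use l0 nn in auto)
  have chi: "chi2_div P1 P0 = (\<integral>\<^sup>+y. ennreal ((l y - 1)\<^sup>2) \<partial>P0)"
    by (simp add: chi2_div_def l_def)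
  have isq: "integrable P0 (\<lambda>y. (l y - 1)\<^sup>2)"
    by (rule integrableI_nonneg) (use assms(5) chi in auto)
  have Esq: "(\<integral>y. (l y - 1)\<^sup>2 \<partial>P0) = enn2real (chi2_div P1 P0)"
    by (subst integral_eq_nn_integral) (auto simp: chi)
  \<comment> \<open>Finite divergence controls \<open>(l - 1)\<close> squared directly; this
    identity transfers integrability and value to the square of \<open>l\<close>.\<close>
  have eq: "(\<lambda>y. (l y)\<^sup>2) = (\<lambda>y. (l y - 1)\<^sup>2 + 2 * l y - 1)"
    by (auto simp: power2_eq_square algebra_simps)
  show "integrable P0 (\<lambda>y. (l y)\<^sup>2)" unfolding eq using isq il by simp
  show "(\<integral>y. (l y)\<^sup>2 \<partial>P0) = 1 + enn2real (chi2_div P1 P0)"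
    unfolding eq using isq il El Esq by (simp add: P0.prob_space)
qed

section \<open>The planted mixture\<close>

text \<open>The factors 1 outside \<open>S\<close> keep the index set equal to \<open>{1..m}\<close>
  for all \<open>S\<close>, so products of two such densities still factorize
  coordinatewise.\<close>

definition planted_density :: "nat \<Rightarrow> ('a \<Rightarrow> real) \<Rightarrow> nat set \<Rightarrow> (nat \<Rightarrow> 'a) \<Rightarrow> real" where
  "planted_density m l S x = (\<Prod>i\<in>{1..m}. if i \<in> S then l (x i) else 1)"

lemma planted_density_nonneg: "(\<And>y. 0 \<le> l y) \<Longrightarrow> 0 \<le> planted_density m l S x"
  unfolding planted_density_def by (intro prod_nonneg) auto

lemma borel_measurable_planted_density:
  assumes [measurable]: "l \<in> borel_measurable P0"
  shows "planted_density m l S \<in> borel_measurable (null_law m P0)"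
  unfolding planted_density_def null_law_def
  by (intro borel_measurable_prod) auto

text \<open>Each coordinate law has a density with respect to the common base \<open>P0\<close>,
  namely \<open>l\<close> on \<open>S\<close> and 1 elsewhere, and densities multiply over
  independent coordinates.\<close>

lemma planted_law_eq_density:
  assumes "prob_space P0" "prob_space P1"
    and l [measurable]: "l \<in> borel_measurable P0" and l0: "\<And>y. 0 \<le> l y"
    and P1: "P1 = density P0 (\<lambda>y. ennreal (l y))"
  shows "planted_law m P0 P1 S = density (null_law m P0) (\<lambda>x. ennreal (planted_density m l S x))"
proof -
  interpret P0: prob_space P0 by fact
  interpret P1: prob_space P1 by fact
  let ?f = "\<lambda>i y. if i \<in> S then ennreal (l y) else 1"
  have d: "density P0 (?f i) = (if i \<in> S then P1 else P0)" for i
    by (simp add: P1 density_1)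
  have ps0: "product_sigma_finite (\<lambda>i::nat. P0)"
    by (simp add: product_sigma_finite_def P0.sigma_finite_measure_axioms)
  have ps: "product_sigma_finite (\<lambda>i. density P0 (?f i))"
    by (simp only: d) (simp add: product_sigma_finite_def P0.sigma_finite_measure_axioms
                         P1.sigma_finite_measure_axioms)
  have "planted_law m P0 P1 S = PiM {1..m} (\<lambda>i. density P0 (?f i))"
    by (simp only: planted_law_def d)
  also have "\<dots> = density (null_law m P0) (\<lambda>x. \<Prod>i\<in>{1..m}. ?f i (x i))"
    unfolding null_law_def by (rule PiM_density[OF ps0 ps]) auto
  also have "(\<lambda>x. \<Prod>i\<in>{1..m}. ?f i (x i)) = (\<lambda>x. ennreal (planted_density m l S x))"
  proof
    fix x :: "nat \<Rightarrow> 'a"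
    have "ennreal (planted_density m l S x)
        = (\<Prod>i\<in>{1..m}. ennreal (if i \<in> S then l (x i) else 1))"
      unfolding planted_density_def by (rule prod_ennreal[symmetric]) (use l0 in auto)
    also have "\<dots> = (\<Prod>i\<in>{1..m}. ?f i (x i))" by (intro prod.cong) auto
    finally show "(\<Prod>i\<in>{1..m}. ?f i (x i)) = ennreal (planted_density m l S x)" by simp
  qed
  finally show ?thesis .
qed

text \<open>Independence under the null law reduces everything to one coordinate. In the mixed
  moment, a coordinate in both sets contributes the mean \<open>c\<close> of the squared ratio; one
  in a single set contributes the mean of \<open>l\<close>, which is 1, and one in neither
  contributes 1.\<close>

lemma planted_density_moments:
  assumes "prob_space P0"
    and il: "integrable P0 l" and El: "(\<integral>y. l y \<partial>P0) = 1"
    and i2: "integrable P0 (\<lambda>y. (l y)\<^sup>2)" and E2: "(\<integral>y. (l y)\<^sup>2 \<partial>P0) = c"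
    and S: "S \<subseteq> {1..m}"
  shows "integrable (null_law m P0) (planted_density m l S)"
    and "(\<integral>x. planted_density m l S x \<partial>null_law m P0) = 1"
    and "integrable (null_law m P0) (\<lambda>x. planted_density m l S x * planted_density m l S' x)"
    and "(\<integral>x. planted_density m l S x * planted_density m l S' x \<partial>null_law m P0) = c ^ card (S \<inter> S')"
proof -
  interpret P0: prob_space P0 by fact
  interpret product_sigma_finite "\<lambda>i::nat. P0"
    by (simp add: product_sigma_finite_def P0.sigma_finite_measure_axioms)
  let ?f = "\<lambda>i y. if i \<in> S then l y else 1"
  have f: "integrable P0 (?f i)" "(\<integral>y. ?f i y \<partial>P0) = 1" for i
    by (cases "i \<in> S"; simp add: il El P0.prob_space)+
  have eq1: "planted_density m l S = (\<lambda>x. \<Prod>i\<in>{1..m}. ?f i (x i))"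
    by (simp add: planted_density_def fun_eq_iff)
  show "integrable (null_law m P0) (planted_density m l S)"
    unfolding eq1 null_law_def by (rule product_integrable_prod) (use f in auto)
  show "(\<integral>x. planted_density m l S x \<partial>null_law m P0) = 1"
    unfolding eq1 null_law_def by (subst product_integral_prod) (use f in auto)
  let ?g = "\<lambda>i y. (if i \<in> S then l y else 1) * (if i \<in> S' then l y else 1)"
  have g: "integrable P0 (?g i)" "(\<integral>y. ?g i y \<partial>P0) = (if i \<in> S \<inter> S' then c else 1)" for i
    using i2 E2
    by (cases "i \<in> S"; cases "i \<in> S'"; simp add: il El P0.prob_space power2_eq_square)+
  have eq2: "(\<lambda>x. planted_density m l S x * planted_density m l S' x)
      = (\<lambda>x. \<Prod>i\<in>{1..m}. ?g i (x i))"
    by (simp add: planted_density_def fun_eq_iff prod.distrib)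
  show "integrable (null_law m P0) (\<lambda>x. planted_density m l S x * planted_density m l S' x)"
    unfolding eq2 null_law_def by (rule product_integrable_prod) (use g in auto)
  have "(\<integral>x. planted_density m l S x * planted_density m l S' x \<partial>null_law m P0)
      = (\<Prod>i\<in>{1..m}. if i \<in> S \<inter> S' then c else 1)"
    unfolding eq2 null_law_def by (subst product_integral_prod) (use g in auto)
  also have "\<dots> = (\<Prod>i\<in>{1..m} \<inter> (S \<inter> S'). c)"
    by (rule prod.inter_restrict[symmetric]) simp
  \<comment> \<open>It suffices that one of the two sets lies in \<open>{1..m}\<close>.\<close>
  also have "{1..m} \<inter> (S \<inter> S') = S \<inter> S'" using S by auto
  finally show "(\<integral>x. planted_density m l S x * planted_density m l S' x \<partial>null_law m P0)
      = c ^ card (S \<inter> S')" by simp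
qed

theorem lemma6:
  fixes P0 P1 :: "'a measure" and \<rho> :: real and m k :: nat
  assumes "prob_space P0" and "prob_space P1"
    and "sets P1 = sets P0"
    and "absolutely_continuous P0 P1"
    and "chi2_div P1 P0 < \<infinity>"
    and "\<rho>\<^sup>2 = enn2real (chi2_div P1 P0)"
    and "1 \<le> k" and "k \<le> m"
  shows "(\<forall>\<phi>. is_test m P0 \<phi> \<longrightarrow>
            type1_error m P0 \<phi> + avg_type2_error m k P0 P1 \<phi> \<ge> 1 - min 1 (C_fix m k \<rho>))
       \<and> measure_pmf.expectation (overlap_pmf m k) (\<lambda>J. (1 + \<rho>\<^sup>2) ^ J)
           \<le> (1 + real k * \<rho>\<^sup>2 / real m) ^ k"
proof (intro conjI allI impI)
  show "measure_pmf.expectation (overlap_pmf m k) (\<lambda>J. (1 + \<rho>\<^sup>2) ^ J)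
      \<le> (1 + real k * \<rho>\<^sup>2 / real m) ^ k"
    by (rule expectation_power_overlap_le) (use assms in auto)
next
  fix \<phi> assume test: "is_test m P0 \<phi>"
  obtain l where l: "l \<in> borel_measurable P0" "\<And>y. 0 \<le> l y"
      "P1 = density P0 (\<lambda>y. ennreal (l y))"
    and mom: "integrable P0 l" "(\<integral>y. l y \<partial>P0) = 1"
      "integrable P0 (\<lambda>y. (l y)\<^sup>2)" "(\<integral>y. (l y)\<^sup>2 \<partial>P0) = 1 + \<rho>\<^sup>2"
    using chi2_density_moments[OF assms(1-5)] assms(6) by metis
  let ?N = "null_law m P0" and ?K = "k_subsets m k" and ?D = "planted_density m l"
  define n where "n = real (m choose k)"
  \<comment> \<open>The density of the uniform mixture of the planted laws with respect to the null
    law.\<close>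
  define L where "L = (\<lambda>x. inverse n * (\<Sum>S\<in>?K. ?D S x))"
  have n: "0 < n" using assms(8) by (simp add: n_def)
  have K: "S \<subseteq> {1..m}" if "S \<in> ?K" for S using that by (simp add: k_subsets_def)
  interpret N: prob_space ?N
    unfolding null_law_def by (rule prob_space_PiM) (rule assms(1))
  note Dmom = planted_density_moments[OF assms(1) mom K]
  note [measurable] = borel_measurable_planted_density[OF l(1)]
  have \<phi>: "\<phi> \<in> borel_measurable ?N" "\<And>x. x \<in> space ?N \<Longrightarrow> 0 \<le> \<phi> x \<and> \<phi> x \<le> 1"
    using test by (auto simp: is_test_def)
  note [measurable] = \<phi>(1)
  have Lm: "L \<in> borel_measurable ?N" unfolding L_def by measurable
  have L0: "0 \<le> L x" for x
    using n l(2) by (auto simp: L_def intro!: mult_nonneg_nonneg sum_nonneg planted_density_nonneg)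
  have EL: "N.expectation L = 1"
    unfolding L_def using Dmom(1,2) n by (simp add: card_k_subsets n_def)
  \<comment> \<open>The two copies of the sum in the square act as the independent choices of
    \<open>S\<close> and \<open>S'\<close>; after integration this matches
    \<open>expectation_overlap_pmf\<close> term by term.\<close>
  have Lsq: "(\<lambda>x. (L x)\<^sup>2) = (\<lambda>x. (\<Sum>S\<in>?K. \<Sum>S'\<in>?K. ?D S x * ?D S' x) / n\<^sup>2)"
    by (simp add: L_def power_mult_distrib power2_eq_square sum_product field_simps)
  have iLsq: "integrable ?N (\<lambda>x. (L x)\<^sup>2)"
    unfolding Lsq using Dmom(3) by (intro integrable_divide Bochner_Integration.integrable_sum) auto
  have ELsq: "N.expectation (\<lambda>x. (L x)\<^sup>2)
      = measure_pmf.expectation (overlap_pmf m k) (\<lambda>J. (1 + \<rho>\<^sup>2) ^ J)"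
    unfolding Lsq expectation_overlap_pmf[OF assms(8)] n_def
    using Dmom(3,4) by (simp add: Bochner_Integration.integral_sum Bochner_Integration.integrable_sum)
  \<comment> \<open>Change of measure to the null law, so that averaging over \<open>S\<close>
    replaces the single densities by \<open>L\<close>.\<close>
  have type2: "(\<integral>x. 1 - \<phi> x \<partial>planted_law m P0 P1 S) = N.expectation (\<lambda>x. ?D S x * (1 - \<phi> x))" for S
    unfolding planted_law_eq_density[OF assms(1,2) l]
    by (subst integral_density) (auto simp: l planted_density_nonneg)
  have iD: "integrable ?N (\<lambda>x. ?D S x * (1 - \<phi> x))" if "S \<in> ?K" for S
  proof (rule Bochner_Integration.integrable_bound[OF Dmom(1)[OF that]])
    show "AE x in ?N. norm (?D S x * (1 - \<phi> x)) \<le> norm (?D S x)"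
      using \<phi>(2) by (intro AE_I2) (auto simp: abs_mult intro!: mult_left_le)
  qed simp
  have b: "avg_type2_error m k P0 P1 \<phi> = N.expectation (\<lambda>x. L x * (1 - \<phi> x))"
    unfolding avg_type2_error_def type2 L_def n_def[symmetric]
    using iD by (simp add: sum_distrib_right mult.assoc)
  \<comment> \<open>Nonnegativity of the two errors covers the case where the minimum is 1, in which
    the claimed lower bound is 0.\<close>
  have "0 \<le> type1_error m P0 \<phi>"
    unfolding type1_error_def using \<phi>(2) by (intro integral_nonneg_AE AE_I2) auto
  moreover have "0 \<le> avg_type2_error m k P0 P1 \<phi>"
    unfolding b using \<phi>(2) L0 by (intro integral_nonneg_AE AE_I2) auto
  moreover have "type1_error m P0 \<phi> + avg_type2_error m k P0 P1 \<phi> \<ge> 1 - C_fix m k \<rho>"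
    using N.testing_error_ge[OF Lm iLsq EL \<phi>] by (simp add: b type1_error_def C_fix_def ELsq)
  ultimately show "type1_error m P0 \<phi> + avg_type2_error m k P0 P1 \<phi> \<ge> 1 - min 1 (C_fix m k \<rho>)"
    by (simp add: min_def)
qed

end
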